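(* Let $n\ge 1$, let $c\in\mathbb{Z}^n$ be a coloring vector, and let $M\in\mathbb{R}^{n\times n}$. For each $k\in K_c$ let $w^{(k)}:=Mb^{(k)}\in\mathbb{R}^n$. Then the polydiagonal subspace $\Delta_{\mathcal{P}_c}$ of $\mathbb{R}^n$ is invariant under $M$ (that is, $M\Delta_{\mathcal{P}_c}\subseteq\Delta_{\mathcal{P}_c}$) if and only if for all $k\in K_c$ the conditions (1) $c_i=c_j$ implies $w^{(k)}_i=w^{(k)}_j$; (2) $c_i=-c_j$ implies $w^{(k)}_i=-w^{(k)}_j$; (3) $c_i=0$ implies $w^{(k)}_i=0$ hold for all distinct $i,j\in\{1,\ldots,n\}$.
   Context: An element $c\in\mathbb{Z}^n$ is a coloring vector if $c_1\in\{0,1\}$ and $-m_i\le c_i\le 1+m_i$ for all $i\in\{2,\ldots,n\}$, where $m_i:=\max\{c_1,\ldots,c_{i-1}\}$. For a coloring vector $c$, the associated polydiagonal subspace is $\Delta_{\mathcal{P}_c}=\{x\in\mathbb{R}^n \mid x_i=x_j \text{ whenever } c_i=c_j, \text{ and } x_i=-x_j \text{ whenever } c_i=-c_j\}$, where $i,j$ range over $\{1,\ldots,n\}$ and $i=j$ is allowed (so $c_i=0$ forces $x_i=0$). The set of colors of $c$ is $K_c:=\{|c_i| : 1\le i\le n\}\setminus\{0\}$. For $k\in K_c$ the vector $b^{(k)}\in\{-1,0,1\}^n$ is defined by $b^{(k)}_i=1$ if $c_i=k$, $b^{(k)}_i=-1$ if $c_i=-k$, and $b^{(k)}_i=0$ otherwise.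 *)

theory Defs
  imports "Jordan_Normal_Form.Matrix"
begin

text \<open>Vectors and matrices are those of \<^theory>\<open>Jordan_Normal_Form.Matrix\<close>, which are indexed
  from 0: the mathematical index set \<open>{1,...,n}\<close> becomes \<open>{0..<n}\<close>, entry \<open>i\<close> of the
  mathematical vector being entry \<open>i - 1\<close> here.\<close>

definition coloring_vector :: "nat \<Rightarrow> int vec \<Rightarrow> bool" where
  "coloring_vector n c \<longleftrightarrow>
     c \<in> carrier_vec n \<and> c $ 0 \<in> {0, 1} \<and>
     (\<forall>i\<in>{1..<n}. let m = Max ((\<lambda>j. c $ j) ` {0..<i}) in - m \<le> c $ i \<and> c $ i \<le> 1 + m)"

text \<open>The indices \<open>i = j\<close> are allowed below, so \<open>c $ i = 0\<close> forces \<open>x $ i = 0\<close>.\<close>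

definition polydiagonal :: "int vec \<Rightarrow> real vec set" where
  "polydiagonal c =
     {x \<in> carrier_vec (dim_vec c). \<forall>i<dim_vec c. \<forall>j<dim_vec c.
        (c $ i = c $ j \<longrightarrow> x $ i = x $ j) \<and> (c $ i = - c $ j \<longrightarrow> x $ i = - x $ j)}"

definition colors :: "int vec \<Rightarrow> int set" where
  "colors c = {\<bar>c $ i\<bar> | i. i < dim_vec c} - {0}"

definition color_vec :: "int vec \<Rightarrow> int \<Rightarrow> real vec" where
  "color_vec c k =
     vec (dim_vec c) (\<lambda>i. if c $ i = k then 1 else if c $ i = - k then - 1 else 0)"

end

theory Submission
  imports Defs
begin

text \<open>The vectors \<open>color_vec c k\<close>, for \<open>k\<close> a color, lie in the polydiagonal subspace and span
  it, so invariance under \<open>M\<close> need only be tested on their images. Conditions (1)--(3) say that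
  these images lie in the subspace: condition (3) accounts for the case \<open>i = j\<close>, which the
  restriction to distinct indices excludes. For \<open>n = 1\<close> there are no distinct indices, but the
  existence of a color then forces the single entry of \<open>c\<close> to be nonzero.\<close>

lemma finite_colors: "finite (colors c)"
proof -
  have "{\<bar>c $ i\<bar> | i. i < dim_vec c} = (\<lambda>i. \<bar>c $ i\<bar>) ` {..<dim_vec c}"
    by auto
  then show ?thesis
    by (simp add: colors_def)
qed

lemma color_pos: "k \<in> colors c \<Longrightarrow> k > 0"
  by (auto simp: colors_def)

text \<open>At \<open>k = 0\<close> the vector would be 1 wherever \<open>c\<close> vanishes,
  violating the case \<open>i = j\<close>.\<close>

lemma color_vec_in_polydiagonal: "k \<noteq> 0 \<Longrightarrow> color_vec c k \<in> polydiagonal c"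
  by (auto simp: color_vec_def polydiagonal_def)

text \<open>On the entries of \<open>c\<close> with a given absolute value, \<open>x\<close> is
  fixed up to sign by one of its values, so one coefficient per color suffices. The expansion is
  entrywise, which keeps all sums over reals.\<close>

lemma polydiagonal_expansion:
  assumes x: "x \<in> polydiagonal c"
  obtains a where "\<And>i. i < dim_vec c \<Longrightarrow> x $ i = (\<Sum>k\<in>colors c. a k * color_vec c k $ i)"
proof -
  have eq: "x $ i = x $ j" if "i < dim_vec c" "j < dim_vec c" "c $ i = c $ j" for i j
    using x that unfolding polydiagonal_def by blast
  have opp: "x $ i = - x $ j" if "i < dim_vec c" "j < dim_vec c" "c $ i = - c $ j" for i j
    using x that unfolding polydiagonal_def by blast
  have "\<forall>k\<in>colors c. \<exists>p. p < dim_vec c \<and> \<bar>c $ p\<bar> = k"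
    by (auto simp: colors_def)
  then obtain p where p: "\<And>k. k \<in> colors c \<Longrightarrow> p k < dim_vec c \<and> \<bar>c $ p k\<bar> = k"
    by metis
  \<comment> \<open>The representative \<open>p k\<close> may carry \<open>- k\<close> instead of
    \<open>k\<close>; the sign makes \<open>a k\<close> the value that belongs to the color
    \<open>k\<close> itself.\<close>
  define a where "a k = (if c $ p k = k then x $ p k else - x $ p k)" for k
  have "x $ i = (\<Sum>k\<in>colors c. a k * color_vec c k $ i)" if i: "i < dim_vec c" for i
  proof (cases "c $ i = 0")
    case True
    have "color_vec c k $ i = 0" if "k \<in> colors c" for k
      using color_pos[OF that] True i by (simp add: color_vec_def)
    moreover have "x $ i = 0"
      using opp[of i i] i True by simp
    ultimately show ?thesis by simp
  next
    case False
    define k where "k = \<bar>c $ i\<bar>"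
    have k: "k \<in> colors c"
      using False i by (auto simp: colors_def k_def)
    \<comment> \<open>Colors are positive, so different colors have disjoint supports and only the
      term of \<open>k\<close> survives.\<close>
    have "color_vec c l $ i = 0" if "l \<in> colors c - {k}" for l
      using that color_pos[of l c] i by (auto simp: color_vec_def k_def)
    then have "(\<Sum>l\<in>colors c. a l * color_vec c l $ i) = a k * color_vec c k $ i"
      by (simp add: sum.remove[OF finite_colors k])
    also have "\<dots> = x $ i"
    proof -
      have "c $ i = c $ p k \<or> c $ i = - c $ p k" "c $ p k = k \<or> c $ p k = - k"
        using p[OF k] unfolding k_def by linarith+
      moreover have "x $ i = x $ p k" if "c $ i = c $ p k"
        using eq i p[OF k] that by blast
      moreover have "x $ i = - x $ p k" if "c $ i = - c $ p k"
        using opp i p[OF k] that by blast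
      ultimately show ?thesis
        using color_pos[OF k] i unfolding a_def color_vec_def by auto
    qed
    finally show ?thesis by simp
  qed
  then show thesis by (rule that)
qed

lemma mult_polydiagonal_expansion:
  assumes M: "M \<in> carrier_mat (dim_vec c) (dim_vec c)" and x: "x \<in> polydiagonal c"
  obtains a where
    "\<And>i. i < dim_vec c \<Longrightarrow> (M *\<^sub>v x) $ i = (\<Sum>k\<in>colors c. a k * (M *\<^sub>v color_vec c k) $ i)"
proof -
  obtain a where a: "\<And>j. j < dim_vec c \<Longrightarrow> x $ j = (\<Sum>k\<in>colors c. a k * color_vec c k $ j)"
    using polydiagonal_expansion[OF x] by metis
  have dims: "dim_vec x = dim_vec c" "\<And>k. dim_vec (color_vec c k) = dim_vec c"
    using x by (auto simp: polydiagonal_def color_vec_def)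
  have "(M *\<^sub>v x) $ i = (\<Sum>k\<in>colors c. a k * (M *\<^sub>v color_vec c k) $ i)" if i: "i < dim_vec c" for i
  proof -
    have "(M *\<^sub>v x) $ i = (\<Sum>j<dim_vec c. M $$ (i, j) * x $ j)"
      using M i dims by (simp add: scalar_prod_def atLeast0LessThan)
    also have "\<dots> = (\<Sum>j<dim_vec c. \<Sum>k\<in>colors c. a k * (M $$ (i, j) * color_vec c k $ j))"
      by (simp add: a sum_distrib_left mult.left_commute)
    also have "\<dots> = (\<Sum>k\<in>colors c. \<Sum>j<dim_vec c. a k * (M $$ (i, j) * color_vec c k $ j))"
      by (rule sum.swap)
    also have "\<dots> = (\<Sum>k\<in>colors c. a k * (M *\<^sub>v color_vec c k) $ i)"
      using M i dims by (simp add: scalar_prod_def atLeast0LessThan sum_distrib_left)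
    finally show ?thesis .
  qed
  then show thesis by (rule that)
qed

text \<open>The equations defining \<open>polydiagonal c\<close> are linear, so they pass from the
  images of the color vectors to every combination of these images.\<close>

lemma invariant_iff_color_vecs:
  assumes M: "M \<in> carrier_mat (dim_vec c) (dim_vec c)"
  shows "(\<lambda>x. M *\<^sub>v x) ` polydiagonal c \<subseteq> polydiagonal c \<longleftrightarrow>
    (\<forall>k\<in>colors c. M *\<^sub>v color_vec c k \<in> polydiagonal c)"
proof
  assume "(\<lambda>x. M *\<^sub>v x) ` polydiagonal c \<subseteq> polydiagonal c"
  then show "\<forall>k\<in>colors c. M *\<^sub>v color_vec c k \<in> polydiagonal c"
    using color_vec_in_polydiagonal color_pos by (metis image_subset_iff less_irrefl)
next
  assume inv: "\<forall>k\<in>colors c. M *\<^sub>v color_vec c k \<in> polydiagonal c"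
  have "M *\<^sub>v x \<in> polydiagonal c" if x: "x \<in> polydiagonal c" for x
  proof -
    obtain a where a: "\<And>i. i < dim_vec c \<Longrightarrow>
        (M *\<^sub>v x) $ i = (\<Sum>k\<in>colors c. a k * (M *\<^sub>v color_vec c k) $ i)"
      using mult_polydiagonal_expansion[OF M x] by metis
    have "(M *\<^sub>v x) $ i = (M *\<^sub>v x) $ j"
      if "i < dim_vec c" "j < dim_vec c" "c $ i = c $ j" for i j
      unfolding a[OF that(1)] a[OF that(2)]
    proof (rule sum.cong)
      fix k assume "k \<in> colors c"
      then have "(M *\<^sub>v color_vec c k) $ i = (M *\<^sub>v color_vec c k) $ j"
        using inv that unfolding polydiagonal_def by blast
      then show "a k * (M *\<^sub>v color_vec c k) $ i = a k * (M *\<^sub>v color_vec c k) $ j"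
        by simp
    qed simp
    moreover have "(M *\<^sub>v x) $ i = - (M *\<^sub>v x) $ j"
      if "i < dim_vec c" "j < dim_vec c" "c $ i = - c $ j" for i j
      \<comment> \<open>The minus sign moves inside the sum so that both sides can be compared term
        by term.\<close>
      unfolding a[OF that(1)] a[OF that(2)] sum_negf[symmetric]
    proof (rule sum.cong)
      fix k assume "k \<in> colors c"
      then have "(M *\<^sub>v color_vec c k) $ i = - (M *\<^sub>v color_vec c k) $ j"
        using inv that unfolding polydiagonal_def by blast
      then show "a k * (M *\<^sub>v color_vec c k) $ i = - (a k * (M *\<^sub>v color_vec c k) $ j)"
        by simp
    qed simp
    ultimately show ?thesis
      using mult_mat_vec_carrier[OF M] x unfolding polydiagonal_def by blast
  qed
  then show "(\<lambda>x. M *\<^sub>v x) ` polydiagonal c \<subseteq> polydiagonal c"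
    by blast
qed

lemma polydiagonal_iff_distinct:
  assumes v: "v \<in> carrier_vec (dim_vec c)" and k: "k \<in> colors c"
  shows "v \<in> polydiagonal c \<longleftrightarrow>
    (\<forall>i<dim_vec c. \<forall>j<dim_vec c. i \<noteq> j \<longrightarrow>
        (c $ i = c $ j \<longrightarrow> v $ i = v $ j) \<and>
        (c $ i = - c $ j \<longrightarrow> v $ i = - v $ j) \<and>
        (c $ i = 0 \<longrightarrow> v $ i = 0))"
    (is "_ \<longleftrightarrow> ?R")
proof
  assume "v \<in> polydiagonal c"
  then have eq: "c $ i = c $ j \<Longrightarrow> v $ i = v $ j"
    and opp: "c $ i = - c $ j \<Longrightarrow> v $ i = - v $ j"
    if "i < dim_vec c" "j < dim_vec c" for i j
    using that unfolding polydiagonal_def by blast+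
  have "v $ i = 0" if "i < dim_vec c" "c $ i = 0" for i
    using opp[of i i] that by simp
  with eq opp show ?R by blast
next
  assume R: ?R
  \<comment> \<open>Any \<open>i\<close> with \<open>c $ i = 0\<close> differs from
    \<open>p\<close>, so \<open>?R\<close> applies to the pair \<open>i\<close>, \<open>p\<close>
    and yields \<open>v $ i = 0\<close>.\<close>
  obtain p where p: "p < dim_vec c" "c $ p \<noteq> 0"
    using k by (auto simp: colors_def)
  have zero: "v $ i = 0" if "i < dim_vec c" "c $ i = 0" for i
    using R p that by metis
  have "(c $ i = c $ j \<longrightarrow> v $ i = v $ j) \<and> (c $ i = - c $ j \<longrightarrow> v $ i = - v $ j)"
    if "i < dim_vec c" "j < dim_vec c" for i j
  proof (cases "i = j")
    case True
    \<comment> \<open>Here \<open>c $ i = - c $ i\<close> forces \<open>c $ i = 0\<close>.\<close>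
    then show ?thesis using zero that by simp
  next
    case False
    then show ?thesis using R that by blast
  qed
  with v show "v \<in> polydiagonal c"
    unfolding polydiagonal_def by blast
qed

theorem proposition4p2:
  fixes n :: nat and c :: "int vec" and M :: "real mat" and w :: "int \<Rightarrow> real vec"
  assumes "n \<ge> 1"
    and "coloring_vector n c"
    and "M \<in> carrier_mat n n"
    and "\<And>k. k \<in> colors c \<Longrightarrow> w k = M *\<^sub>v color_vec c k"
  shows "(\<lambda>x. M *\<^sub>v x) ` polydiagonal c \<subseteq> polydiagonal c \<longleftrightarrow>
    (\<forall>k\<in>colors c. \<forall>i<n. \<forall>j<n. i \<noteq> j \<longrightarrow>
        (c $ i = c $ j \<longrightarrow> w k $ i = w k $ j) \<and>
        (c $ i = - c $ j \<longrightarrow> w k $ i = - w k $ j) \<and>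
        (c $ i = 0 \<longrightarrow> w k $ i = 0))"
proof -
  have n: "dim_vec c = n"
    using assms(2) by (auto simp: coloring_vector_def)
  have M: "M \<in> carrier_mat (dim_vec c) (dim_vec c)"
    using assms(3) n by simp
  have w: "w k \<in> carrier_vec (dim_vec c)" if "k \<in> colors c" for k
    unfolding assms(4)[OF that] using M by (intro mult_mat_vec_carrier) (auto simp: color_vec_def)
  have "(\<lambda>x. M *\<^sub>v x) ` polydiagonal c \<subseteq> polydiagonal c \<longleftrightarrow>
      (\<forall>k\<in>colors c. w k \<in> polydiagonal c)"
    \<comment> \<open>\<open>w\<close> is prescribed on colors only, so the rewriting needs the
      membership that \<open>ball_cong\<close> supplies.\<close>
    unfolding invariant_iff_color_vecs[OF M] by (rule ball_cong) (simp_all only: assms(4))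
  then show ?thesis
    unfolding n[symmetric] using polydiagonal_iff_distinct[OF w] by blast
qed

end
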